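(* For every pair of independent e-variables $E_1,E_2$, $$\mathbb P\{K_2^{\mathrm{ad}}(E_1,E_2)\le\alpha\}\le\alpha,\qquad 0\le\alpha\le1 .$$ That is, $K_2^{\mathrm{ad}}$ is an e-to-p merger (for $n=2$).
   Context: An e-variable is a nonnegative (finite-valued) random variable $E$ with $\mathbb E[E]\le 1$. A Borel function $F:[0,\infty)^n\to[0,1]$ is an e-to-p merger if $\mathbb P\{F(E_1,\ldots,E_n)\le\alpha\}\le\alpha$ for all $\alpha\in[0,1]$ and every collection of independent e-variables $E_1,\dots,E_n$. The function $K_2^{\mathrm{ad}}:[0,\infty)^2\to[0,1]$ is symmetric and is defined, with $a$ the minimum and $b$ the maximum of the two arguments, by $$K_2^{\mathrm{ad}}(a,b)=\begin{cases}1,& b\le 1,\\ \dfrac{2}{\tau(a,b)}-\dfrac1{\tau(a,b)^2},& 0\le a<1<b,\\ \dfrac1{ab},& 1\le a,\end{cases}$$ where for $0\le a<1<b$, $\tau(a,b)=\tfrac12\bigl(b(1+a)+\sqrt{b^2(1+a)^2-4ab}\bigr)$ is the larger root of $t^2-b(1+a)t+ab=0$. *)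

theory Defs
  imports "HOL-Probability.Probability"
begin

text \<open>Nonnegativity holds at every sample point, not just almost surely, since mergers are only
  specified on the nonnegative orthant. For a nonnegative random variable with mean at most 1,
  integrability is automatic; it has to be demanded here because the Bochner integral of a
  non-integrable function is 0.\<close>

definition e_variable :: "'a measure \<Rightarrow> ('a \<Rightarrow> real) \<Rightarrow> bool" where
  "e_variable M E \<longleftrightarrow>
     E \<in> borel_measurable M \<and> (\<forall>\<omega>\<in>space M. 0 \<le> E \<omega>) \<and>
     integrable M E \<and> integral\<^sup>L M E \<le> 1"

text \<open>The number of arguments is \<open>CARD('n)\<close>. A formula cannot quantify over
  types, so the type of sample points is a parameter; a theorem in which it is a
  type variable covers all probability spaces. Only the values of \<open>F\<close> on the nonnegative
  orthant matter.\<close>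

definition e_to_p_merger :: "'a itself \<Rightarrow> (real ^ 'n \<Rightarrow> real) \<Rightarrow> bool" where
  "e_to_p_merger (_ :: 'a itself) F \<longleftrightarrow>
     F \<in> borel_measurable (restrict_space borel {x. \<forall>i. 0 \<le> x $ i}) \<and>
     (\<forall>x. (\<forall>i. 0 \<le> x $ i) \<longrightarrow> F x \<in> {0..1}) \<and>
     (\<forall>(M :: 'a measure) (E :: 'n \<Rightarrow> 'a \<Rightarrow> real).
        prob_space M \<longrightarrow> (\<forall>i. e_variable M (E i)) \<longrightarrow>
        prob_space.indep_vars M (\<lambda>_. borel) E UNIV \<longrightarrow>
        (\<forall>\<alpha>\<in>{0..1}. measure M {\<omega> \<in> space M. F (\<chi> i. E i \<omega>) \<le> \<alpha>} \<le> \<alpha>))"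

definition tau :: "real \<Rightarrow> real \<Rightarrow> real" where
  "tau a b = (b * (1 + a) + sqrt (b\<^sup>2 * (1 + a)\<^sup>2 - 4 * a * b)) / 2"

definition K2ad :: "real \<Rightarrow> real \<Rightarrow> real" where
  "K2ad x y =
     (let a = min x y; b = max x y in
      if b \<le> 1 then 1
      else if a < 1 then 2 / tau a b - 1 / (tau a b)\<^sup>2
      else 1 / (a * b))"

end

theory Submission
  imports Defs
begin

text \<open>
  Fix a level \<open>\<alpha> < 1\<close> and put \<open>s = sqrt (1 - \<alpha>)\<close>. On the nonnegative quadrant the event
  \<open>K2ad x y \<le> \<alpha>\<close> is, for \<open>a = min x y\<close> and \<open>b = max x y\<close>, the polynomial condition
  \<open>(1 - s) b (1 + s a) \<ge> 1\<close> if \<open>a < 1\<close> and \<open>\<alpha> a b \<ge> 1\<close> otherwise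
  (\<open>K2ad_le_iff_rejects\<close>). The probability of this region under a product law is bilinear in
  the two marginals. Laws on the half-line with mean \<open>1\<close> are mixtures of laws of mean \<open>1\<close>
  with at most two atoms, so the worst case is a pair of two-point laws, at \<open>u < 1 < v\<close>
  and at \<open>y < 1 < z\<close>. There the bound is a statement about which of four
  points lie in the region (\<open>four_point_inequality\<close>).

  The reduction to two-point laws uses no decomposition of measures. A function is at most \<open>c\<close>
  in expectation under all two-point laws of mean \<open>1\<close> exactly when its chords across the point
  \<open>1\<close> pass at or below height \<open>c\<close> there; if it is also at most \<open>c\<close> on \<open>[0, 1]\<close>, then some
  nondecreasing line through \<open>(1, c)\<close> lies above the whole function (\<open>affine_majorant_at_one\<close>). Taking expectations of this line gives the bound for
  every e-variable (\<open>expectation_le_of_two_point_laws\<close>). This principle is applied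
  to \<open>E1\<close>, with the conditional rejection probability as the function, and its chord
  condition is proved by applying the principle a second time, to \<open>E2\<close>.

  Among the four points, \<open>(u, y)\<close> is never in the region. The critical case is the one where both
  \<open>(u, z)\<close> and \<open>(v, y)\<close> are: the two memberships bound the masses of \<open>y\<close> and \<open>u\<close> from
  below by \<open>s\<close> times two factors whose product is \<open>1\<close>, so that acceptance has probability at
  least \<open>s\<^sup>2 = 1 - \<alpha>\<close>.
\<close>

section \<open>Expectation bounds from two-point laws\<close>

text \<open>The chord hypothesis, divided by \<open>(v - 1) (1 - u)\<close>, says that every slope from \<open>(1, c)\<close> to a
  point of the graph on the right is at most every slope to a point on the left. A line separating
  the two families has as slope the supremum of the right slopes; including \<open>0\<close> in that supremum
  makes the line nondecreasing, and keeps it above the graph on the left because \<open>\<phi> \<le> c\<close> there.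
  The sign matters later: e-variables have mean at most \<open>1\<close>, not exactly \<open>1\<close>.\<close>

lemma affine_majorant_at_one:
  fixes \<phi> :: "real \<Rightarrow> real"
  assumes below: "\<And>u. 0 \<le> u \<Longrightarrow> u \<le> 1 \<Longrightarrow> \<phi> u \<le> c"
    and chord: "\<And>u v. 0 \<le> u \<Longrightarrow> u < 1 \<Longrightarrow> 1 < v \<Longrightarrow> (v - 1) * \<phi> u + (1 - u) * \<phi> v \<le> c * (v - u)"
  obtains l where "0 \<le> l" "\<And>x. 0 \<le> x \<Longrightarrow> \<phi> x \<le> c + l * (x - 1)"
proof
  define S where "S = insert 0 ((\<lambda>v. (\<phi> v - c) / (v - 1)) ` {1<..})"
  have ub: "t \<le> (c - \<phi> u) / (1 - u)" if "t \<in> S" "0 \<le> u" "u < 1" for t u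
  proof -
    have "(\<phi> v - c) / (v - 1) \<le> (c - \<phi> u) / (1 - u)" if "1 < v" for v
    proof -
      have "(\<phi> v - c) * (1 - u) \<le> (c - \<phi> u) * (v - 1)"
        using chord[of u v] \<open>0 \<le> u\<close> \<open>u < 1\<close> that by (simp add: algebra_simps)
      then show ?thesis
        using \<open>u < 1\<close> that by (simp add: pos_divide_le_eq pos_le_divide_eq mult.commute)
    qed
    then show ?thesis using that below[of u] by (auto simp: S_def)
  qed
  have bdd: "bdd_above S"
    using ub[of _ 0] by (auto intro!: bdd_aboveI)
  show "0 \<le> Sup S"
    by (rule cSup_upper[OF _ bdd]) (simp add: S_def)
  fix x :: real assume "0 \<le> x"
  consider "x < 1" | "x = 1" | "1 < x" by linarith
  then show "\<phi> x \<le> c + Sup S * (x - 1)"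
  proof cases
    case 1
    have "Sup S \<le> (c - \<phi> x) / (1 - x)"
      by (rule cSup_least) (use ub \<open>0 \<le> x\<close> 1 in \<open>auto simp: S_def\<close>)
    then show ?thesis using 1 by (simp add: field_simps)
  next
    case 2
    then show ?thesis using below[of 1] by simp
  next
    case 3
    have "(\<phi> x - c) / (x - 1) \<le> Sup S"
      by (rule cSup_upper[OF _ bdd]) (use 3 in \<open>auto simp: S_def\<close>)
    then show ?thesis using 3 by (simp add: field_simps)
  qed
qed

lemma expectation_le_of_two_point_laws:
  assumes "prob_space M" and X: "e_variable M X"
    and int: "integrable M (\<lambda>\<omega>. \<phi> (X \<omega>))"
    and below: "\<And>u. 0 \<le> u \<Longrightarrow> u \<le> 1 \<Longrightarrow> \<phi> u \<le> c"
    and chord: "\<And>u v. 0 \<le> u \<Longrightarrow> u < 1 \<Longrightarrow> 1 < v \<Longrightarrow> (v - 1) * \<phi> u + (1 - u) * \<phi> v \<le> c * (v - u)"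
  shows "(\<integral>\<omega>. \<phi> (X \<omega>) \<partial>M) \<le> c"
proof -
  interpret prob_space M by fact
  obtain l where l: "0 \<le> l" "\<And>x. 0 \<le> x \<Longrightarrow> \<phi> x \<le> c + l * (x - 1)"
    by (rule affine_majorant_at_one[of \<phi> c]) (use below chord in auto)
  have intX: "integrable M X" and nonneg: "\<And>\<omega>. \<omega> \<in> space M \<Longrightarrow> 0 \<le> X \<omega>"
    and EX: "expectation X \<le> 1"
    using X by (auto simp: e_variable_def)
  have "(\<integral>\<omega>. \<phi> (X \<omega>) \<partial>M) \<le> (\<integral>\<omega>. c + l * (X \<omega> - 1) \<partial>M)"
    by (rule integral_mono) (use int intX l nonneg in auto)
  also have "\<dots> = c + l * (expectation X - 1)"
    using intX by (simp add: prob_space)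
  also have "\<dots> \<le> c"
    using l(1) EX by (simp add: mult_nonneg_nonpos)
  finally show ?thesis .
qed

section \<open>Independent random variables\<close>

text \<open>Fubini for the joint law, pulled back to the sample space, so that the outer integral is
  the expectation of a function of \<open>X\<close>.\<close>

lemma prob_indep_var_eq_integral_sections:
  assumes "prob_space M" and ind: "prob_space.indep_var M S X T Y"
    and A: "A \<in> sets (S \<Otimes>\<^sub>M T)"
  shows "measure M {\<omega> \<in> space M. (X \<omega>, Y \<omega>) \<in> A}
       = (\<integral>\<omega>. measure M {\<omega>' \<in> space M. (X \<omega>, Y \<omega>') \<in> A} \<partial>M)"
    and "(\<lambda>\<omega>. measure M {\<omega>' \<in> space M. (X \<omega>, Y \<omega>') \<in> A}) \<in> borel_measurable M"
proof -
  interpret prob_space M by fact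
  have X[measurable]: "X \<in> measurable M S" and Y[measurable]: "Y \<in> measurable M T"
    and eq: "distr M S X \<Otimes>\<^sub>M distr M T Y = distr M (S \<Otimes>\<^sub>M T) (\<lambda>\<omega>. (X \<omega>, Y \<omega>))"
    using ind by (auto simp: indep_var_distribution_eq)
  interpret DX: prob_space "distr M S X" by (rule prob_space_distr) fact
  interpret DY: prob_space "distr M T Y" by (rule prob_space_distr) fact
  have A': "A \<in> sets (distr M S X \<Otimes>\<^sub>M distr M T Y)"
    using A by (simp cong: sets_pair_measure_cong)
  have sec: "measure (distr M T Y) (Pair x -` A) = measure M {\<omega>' \<in> space M. (x, Y \<omega>') \<in> A}" for x
    using A by (subst measure_distr)
      (auto intro!: sets_Pair1 arg_cong[where f = "measure M"])
  have meas: "(\<lambda>x. measure (distr M T Y) (Pair x -` A)) \<in> borel_measurable S"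
    using DY.measurable_emeasure_Pair[OF A'] by (simp add: measure_def)
  show "(\<lambda>\<omega>. measure M {\<omega>' \<in> space M. (X \<omega>, Y \<omega>') \<in> A}) \<in> borel_measurable M"
    using measurable_compose[OF X meas] by (simp add: sec)
  have "ennreal (measure M {\<omega> \<in> space M. (X \<omega>, Y \<omega>) \<in> A})
      = emeasure (distr M (S \<Otimes>\<^sub>M T) (\<lambda>\<omega>. (X \<omega>, Y \<omega>))) A"
    using A by (subst emeasure_distr)
      (auto simp: emeasure_eq_measure intro!: arg_cong[where f = "measure M"])
  also have "\<dots> = (\<integral>\<^sup>+x. emeasure (distr M T Y) (Pair x -` A) \<partial>distr M S X)"
    unfolding eq[symmetric] by (rule DY.emeasure_pair_measure_alt[OF A'])
  also have "\<dots> = (\<integral>\<^sup>+x. ennreal (measure (distr M T Y) (Pair x -` A)) \<partial>distr M S X)"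
    by (simp add: DY.emeasure_eq_measure)
  also have "\<dots> = ennreal (\<integral>x. measure (distr M T Y) (Pair x -` A) \<partial>distr M S X)"
    by (rule nn_integral_eq_integral)
      (use meas in \<open>auto intro!: DX.integrable_const_bound[where B = 1]\<close>)
  also have "(\<integral>x. measure (distr M T Y) (Pair x -` A) \<partial>distr M S X)
      = (\<integral>\<omega>. measure M {\<omega>' \<in> space M. (X \<omega>, Y \<omega>') \<in> A} \<partial>M)"
    using meas by (simp add: integral_distr sec)
  finally show "measure M {\<omega> \<in> space M. (X \<omega>, Y \<omega>) \<in> A}
       = (\<integral>\<omega>. measure M {\<omega>' \<in> space M. (X \<omega>, Y \<omega>') \<in> A} \<partial>M)"
    by (simp add: integral_nonneg_AE)
qed

lemma indep_var_of_indep_vars: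
  assumes "prob_space M" and ind: "prob_space.indep_vars M N X I" and ij: "i \<in> I" "j \<in> I" "i \<noteq> j"
  shows "prob_space.indep_var M (N i) (X i) (N j) (X j)"
proof -
  interpret prob_space M by fact
  define F where "F k = sigma_sets (space M) {X k -` A \<inter> space M |A. A \<in> sets (N k)}" for k
  have rv: "\<And>k. k \<in> I \<Longrightarrow> random_variable (N k) (X k)" and F: "indep_sets F I"
    using ind by (auto simp: indep_vars_def F_def[abs_def])
  have "indep_set (F i) (F j)"
  proof (rule indep_setI)
    show "F i \<subseteq> events" "F j \<subseteq> events" using F ij by (auto simp: indep_sets_def)
    fix a b assume "a \<in> F i" "b \<in> F j"
    then show "prob (a \<inter> b) = prob a * prob b"
      using indep_setsD[OF F, of "{i, j}" "\<lambda>k. if k = i then a else b"] ij by (auto simp: Int_commute)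
  qed
  then show ?thesis using rv ij by (simp add: indep_var_eq F_def)
qed

section \<open>The rejection region\<close>

text \<open>The region where \<open>K2ad x y \<le> 1 - s\<^sup>2\<close>. Its form has no division and no square root, and it
  stays meaningful at \<open>s = 1\<close> (level \<open>0\<close>), where the region is empty.\<close>

definition rejects :: "real \<Rightarrow> real \<Rightarrow> real \<Rightarrow> bool" where
  "rejects s x y =
     (let a = min x y; b = max x y in
      if a < 1 then 1 \<le> (1 - s) * b * (1 + s * a) else 1 \<le> (1 - s\<^sup>2) * a * b)"

lemma rejects_commute: "rejects s x y = rejects s y x"
  by (simp add: rejects_def min.commute max.commute)

lemma not_rejects_unit_square:
  assumes "0 < s" "s \<le> 1" "0 \<le> x" "x \<le> 1" "0 \<le> y" "y \<le> 1"
  shows "\<not> rejects s x y"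
proof -
  define a b where "a = min x y" and "b = max x y"
  have ab: "0 \<le> a" "a \<le> 1" "0 \<le> b" "b \<le> 1" using assms by (auto simp: a_def b_def)
  have s2: "0 < s\<^sup>2" using assms by simp
  have "(1 - s) * b * (1 + s * a) \<le> (1 - s) * 1 * (1 + s * 1)"
    by (intro mult_mono add_left_mono) (use ab assms in auto)
  also have "\<dots> = 1 - s\<^sup>2" by (simp add: power2_eq_square algebra_simps)
  finally have 1: "(1 - s) * b * (1 + s * a) < 1" using s2 by linarith
  have "(1 - s\<^sup>2) * a * b \<le> (1 - s\<^sup>2) * 1 * 1"
    by (intro mult_mono) (use ab assms in \<open>auto simp: power_le_one\<close>)
  also have "\<dots> < 1" using s2 by simp
  finally have "(1 - s\<^sup>2) * a * b < 1" .
  with 1 show ?thesis by (simp add: rejects_def a_def b_def Let_def)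
qed

text \<open>Since \<open>(1 - s) (1 + s) = 1 - s\<^sup>2\<close>, the region below \<open>x = 1\<close> lies in the half-plane that
  its boundary reaches at \<open>x = 1\<close>, namely \<open>y \<ge> 1 / \<alpha>\<close>. Membership with one small argument
  therefore has probability at most \<open>\<alpha>\<close> by Markov's inequality.\<close>

lemma rejects_below_one_imp:
  assumes s: "0 < s" "s \<le> 1" and "0 \<le> x" "x \<le> 1" "0 \<le> y" and rej: "rejects s x y"
  shows "1 \<le> (1 - s\<^sup>2) * y"
proof -
  have y: "1 < y" using not_rejects_unit_square[of s x y] assms by fastforce
  show ?thesis
  proof (cases "x < 1")
    case True
    have "1 \<le> (1 - s) * y * (1 + s * x)"
      using rej True y by (simp add: rejects_def)
    also have "\<dots> \<le> (1 - s) * y * (1 + s * 1)"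
      by (intro mult_left_mono add_left_mono) (use assms in auto)
    also have "\<dots> = (1 - s\<^sup>2) * y" by (simp add: power2_eq_square algebra_simps)
    finally show ?thesis .
  next
    case False
    then have "x = 1" using assms by simp
    then show ?thesis using rej y by (simp add: rejects_def)
  qed
qed

section \<open>The bound for pairs of two-point laws\<close>

lemma mult_diff_le:
  fixes u v :: real
  assumes "0 \<le> u" "1 \<le> v" shows "v * (1 - u) \<le> v - u"
  using mult_left_mono[OF assms(2,1)] by (simp add: algebra_simps)

text \<open>The two-point law of mean \<open>1\<close> on \<open>z < y\<close> gives \<open>z\<close> the mass \<open>(y - 1) / (y - z)\<close>. If \<open>(x, y)\<close>
  is rejected, then \<open>y\<close> is large, which forces this mass to be at least
  \<open>s (1 - (1 - s) x) / (1 - (1 - s) z)\<close>. The bound is weaker than the optimal one, in exchange for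
  a ratio that is inverted when \<open>x\<close> and \<open>z\<close> are swapped.\<close>

lemma rejects_below_one_mass:
  assumes s: "0 < s" "s \<le> 1" and xy: "0 \<le> x" "x < 1" "1 < y" and z: "0 \<le> z" "z \<le> 1"
    and rej: "rejects s x y"
  shows "s * (1 - (1 - s) * x) * (y - z) \<le> (y - 1) * (1 - (1 - s) * z)"
proof -
  define w where "w = (1 - s) * (1 + s * x)"
  have w: "1 \<le> w * y"
    using rej xy by (simp add: rejects_def w_def mult_ac)
  \<comment> \<open>Replacing \<open>y\<close> by the boundary value \<open>1 / w\<close> turns the mass \<open>(y - 1) / (y - z)\<close> into
    \<open>(1 - w) / (1 - w z)\<close>.\<close>
  have "(y - 1) * (1 - w * z) - (1 - w) * (y - z) = (1 - z) * (w * y - 1)"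
    by (simp add: algebra_simps)
  also have "\<dots> \<ge> 0" using w z by simp
  finally have *: "(1 - w) * (y - z) \<le> (y - 1) * (1 - w * z)" by simp
  have "(1 - s) * z \<le> w * z"
    unfolding w_def by (rule mult_right_mono) (use s xy z mult_left_mono[of 1 "1 + s * x" "1 - s"] in auto)
  then have "(y - 1) * (1 - w * z) \<le> (y - 1) * (1 - (1 - s) * z)"
    using xy by (intro mult_left_mono) auto
  moreover have "1 - w = s * (1 - (1 - s) * x)" by (simp add: w_def algebra_simps)
  ultimately show ?thesis using * by simp
qed

text \<open>Divided by \<open>(v - u) (z - y)\<close>, the left-hand side is the rejection probability under the product
  of the two-point laws of mean \<open>1\<close> on \<open>{u, v}\<close> and on \<open>{y, z}\<close>. If neither \<open>(u, z)\<close>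
  nor \<open>(v, y)\<close> is rejected, only \<open>(v, z)\<close> counts, with probability at most \<open>1 / (v z)\<close>; if exactly
  one of them is, the variable with the large value alone decides; if both are, only \<open>(u, y)\<close>
  is accepted, and its mass is bounded below by the product of the two mass bounds, whose extra
  factors cancel.\<close>

lemma four_point_inequality:
  assumes s: "0 < s" "s \<le> 1"
    and x: "0 \<le> u" "u < 1" "1 < v" and y: "0 \<le> y" "y < 1" "1 < z"
  shows "(z - 1) * ((v - 1) * of_bool (rejects s u y) + (1 - u) * of_bool (rejects s v y))
       + (1 - y) * ((v - 1) * of_bool (rejects s u z) + (1 - u) * of_bool (rejects s v z))
       \<le> (1 - s\<^sup>2) * (v - u) * (z - y)"
proof -
  have uy: "\<not> rejects s u y" using not_rejects_unit_square assms by simp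
  have s2: "0 \<le> 1 - s\<^sup>2" using s by (simp add: power_le_one)
  have le1: "of_bool b \<le> (1::real)" "0 \<le> (of_bool b :: real)" for b by (auto simp: of_bool_def)
  have vu: "v * (1 - u) \<le> v - u" and zy: "z * (1 - y) \<le> z - y"
    using mult_diff_le assms by auto
  have one_arm: "(1 - u) \<le> (1 - s\<^sup>2) * (v - u)" if "1 \<le> (1 - s\<^sup>2) * v" "0 \<le> u" "u < 1" "1 < v" for u v
  proof -
    have "(1 - u) \<le> ((1 - s\<^sup>2) * v) * (1 - u)"
      using mult_right_mono[OF that(1), of "1 - u"] that by simp
    also have "\<dots> \<le> (1 - s\<^sup>2) * (v - u)"
      using mult_left_mono[OF mult_diff_le[of u v] s2] that by (simp add: mult_ac)
    finally show ?thesis .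
  qed
  consider "\<not> rejects s u z" "\<not> rejects s v y" | "rejects s u z" "\<not> rejects s v y"
    | "\<not> rejects s u z" "rejects s v y" | "rejects s u z" "rejects s v y" by blast
  then show ?thesis
  proof cases
    case 1
    show ?thesis
    proof (cases "rejects s v z")
      case True
      then have "1 \<le> (1 - s\<^sup>2) * (v * z)"
        using x y by (auto simp: rejects_def Let_def min_def max_def mult_ac split: if_splits)
      then have "(1 - u) * (1 - y) \<le> (1 - s\<^sup>2) * (v * z) * ((1 - u) * (1 - y))"
        using mult_right_mono[of 1 "(1 - s\<^sup>2) * (v * z)" "(1 - u) * (1 - y)"] x y by simp
      also have "\<dots> = (1 - s\<^sup>2) * ((v * (1 - u)) * (z * (1 - y)))" by (simp add: mult_ac)
      also have "\<dots> \<le> (1 - s\<^sup>2) * ((v - u) * (z - y))"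
        by (intro mult_left_mono mult_mono vu zy s2) (use x y in auto)
      finally show ?thesis using 1 uy True by (simp add: mult_ac)
    next
      case False
      then show ?thesis using 1 uy x y s2 by simp
    qed
  next
    case 2
    have "(v - 1) + (1 - u) * of_bool (rejects s v z) \<le> v - u"
      using mult_left_mono[OF le1(1), of "1 - u" "rejects s v z"] x by simp
    then have "(1 - y) * ((v - 1) + (1 - u) * of_bool (rejects s v z)) \<le> (1 - y) * (v - u)"
      using y by (intro mult_left_mono) auto
    also have "\<dots> \<le> (1 - s\<^sup>2) * (z - y) * (v - u)"
      using one_arm[of z y] rejects_below_one_imp[of s u z] 2 x y s
      by (intro mult_right_mono) auto
    finally show ?thesis using 2 uy by (simp add: mult_ac)
  next
    case 3
    have "(z - 1) + (1 - y) * of_bool (rejects s v z) \<le> z - y"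
      using mult_left_mono[OF le1(1), of "1 - y" "rejects s v z"] y by simp
    then have "(1 - u) * ((z - 1) + (1 - y) * of_bool (rejects s v z)) \<le> (1 - u) * (z - y)"
      using x by (intro mult_left_mono) auto
    also have "\<dots> \<le> (1 - s\<^sup>2) * (v - u) * (z - y)"
      using one_arm[of v u] rejects_below_one_imp[of s y v] 3 x y s
      by (intro mult_right_mono) (auto simp: rejects_commute)
    finally show ?thesis using 3 uy by (simp add: algebra_simps)
  next
    case 4
    define p where "p = 1 - (1 - s) * u"
    define r where "r = 1 - (1 - s) * y"
    have "(1 - s) * t < 1" if "0 \<le> t" "t < 1" for t
      using mult_left_le_one_le[of t "1 - s"] that s by simp
    then have pos: "0 < p" "0 < r" using x y by (auto simp: p_def r_def)
    have "s * p * (z - y) \<le> (z - 1) * r"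
      unfolding p_def r_def using rejects_below_one_mass[of s u z y] 4 x y s by simp
    moreover have "s * r * (v - u) \<le> (v - 1) * p"
      unfolding p_def r_def using rejects_below_one_mass[of s y v u] 4 x y s
      by (simp add: rejects_commute)
    ultimately have "(s * p * (z - y)) * (s * r * (v - u)) \<le> ((z - 1) * r) * ((v - 1) * p)"
      by (rule mult_mono) (use pos s x y in auto)
    then have "(p * r) * (s\<^sup>2 * ((v - u) * (z - y))) \<le> (p * r) * ((z - 1) * (v - 1))"
      by (simp add: power2_eq_square mult_ac)
    then have key: "s\<^sup>2 * ((v - u) * (z - y)) \<le> (z - 1) * (v - 1)"
      using pos by simp
    have "(1 - y) * (1 - u) * of_bool (rejects s v z) \<le> (1 - y) * (1 - u)"
      using mult_left_mono[OF le1(1), of "(1 - y) * (1 - u)" "rejects s v z"] x y by simp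
    then show ?thesis using key 4 uy by (simp add: algebra_simps)
  qed
qed

section \<open>Sublevel sets of the merger\<close>

text \<open>At \<open>t = 1\<close> the quadratic \<open>t\<^sup>2 - b (1 + a) t + a b\<close> takes the value \<open>1 - b < 0\<close>, so \<open>1\<close> lies strictly
  between its roots.\<close>

lemma tau_roots:
  assumes "0 \<le> a" "1 < b"
  obtains t where "tau a b + t = b * (1 + a)" "tau a b * t = a * b" "t < 1" "1 < tau a b"
proof
  define B where "B = b * (1 + a)"
  define D where "D = b\<^sup>2 * (1 + a)\<^sup>2 - 4 * a * b"
  have tau: "tau a b = (B + sqrt D) / 2" by (simp add: tau_def B_def D_def)
  have D: "D = (B - 2)\<^sup>2 + 4 * (b - 1)" "D = B\<^sup>2 - 4 * (a * b)"
    by (simp_all add: D_def B_def power2_eq_square algebra_simps)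
  have "(B - 2)\<^sup>2 < D" using assms D by simp
  then have "\<bar>B - 2\<bar> < sqrt D"
    using real_sqrt_less_mono[of "(B - 2)\<^sup>2" D] by simp
  then show "1 < tau a b" "(B - sqrt D) / 2 < 1" by (auto simp: tau)
  have "0 \<le> D" using \<open>(B - 2)\<^sup>2 < D\<close> by (meson less_le order_trans zero_le_power2)
  then show "tau a b * ((B - sqrt D) / 2) = a * b"
    using D(2) by (simp add: tau field_simps flip: power2_eq_square)
  show "tau a b + (B - sqrt D) / 2 = b * (1 + a)" by (simp add: tau B_def field_simps)
qed

lemma one_minus_square_of_reciprocal:
  "2 / t - 1 / t\<^sup>2 = 1 - (1 - 1 / t)\<^sup>2" for t :: real
  by (simp add: power2_eq_square algebra_simps)

text \<open>Below \<open>a = 1\<close> the merger is \<open>1 - (1 - 1 / \<tau>)\<^sup>2\<close>, so the condition is \<open>(1 - s) \<tau> \<ge> 1\<close>. The other root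
  \<open>t\<close> of the quadratic is below \<open>1\<close>, so \<open>1 - (1 - s) t\<close> is positive; multiplying by it
  turns the condition into a symmetric function of the roots, which their sum and
  product make polynomial in \<open>a\<close> and \<open>b\<close>.\<close>

lemma K2ad_le_iff_rejects:
  assumes s: "0 < s" "s \<le> 1" and xy: "0 \<le> x" "0 \<le> y"
  shows "K2ad x y \<le> 1 - s\<^sup>2 \<longleftrightarrow> rejects s x y"
proof -
  define a b where "a = min x y" and "b = max x y"
  have ab: "0 \<le> a" "a \<le> b" using xy by (auto simp: a_def b_def)
  have K: "K2ad x y = (if b \<le> 1 then 1 else if a < 1 then 2 / tau a b - 1 / (tau a b)\<^sup>2 else 1 / (a * b))"
    by (simp add: K2ad_def a_def b_def Let_def)
  have R: "rejects s x y = (if a < 1 then 1 \<le> (1 - s) * b * (1 + s * a) else 1 \<le> (1 - s\<^sup>2) * a * b)"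
    by (simp add: rejects_def a_def b_def Let_def)
  consider "b \<le> 1" | "1 < b" "a < 1" | "1 < b" "1 \<le> a" by linarith
  then show ?thesis
  proof cases
    case 1
    then show ?thesis
      using not_rejects_unit_square[of s x y] s xy by (simp add: K) (simp add: b_def)
  next
    case 2
    obtain t where t: "tau a b + t = b * (1 + a)" "tau a b * t = a * b" "t < 1" "1 < tau a b"
      using tau_roots ab 2 by metis
    have "K2ad x y \<le> 1 - s\<^sup>2 \<longleftrightarrow> s\<^sup>2 \<le> (1 - 1 / tau a b)\<^sup>2"
      using 2 one_minus_square_of_reciprocal[of "tau a b"]
      by (simp add: K)
    also have "\<dots> \<longleftrightarrow> s \<le> 1 - 1 / tau a b"
      using s t(4) by (simp add: power2_le_iff_abs_le)
    also have "\<dots> \<longleftrightarrow> 1 - (1 - s) * tau a b \<le> 0"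
      using t(4) by (simp add: field_simps)
    also have "\<dots> \<longleftrightarrow> (1 - (1 - s) * tau a b) * (1 - (1 - s) * t) \<le> 0"
    proof -
      have "(1 - s) * t < 1"
      proof (cases "t \<le> 0")
        case True
        then show ?thesis using s by (smt (verit) mult_nonneg_nonpos)
      next
        case False
        then show ?thesis using s t(3) mult_left_le_one_le[of t "1 - s"] by linarith
      qed
      then show ?thesis by (simp add: mult_le_0_iff)
    qed
    also have "(1 - (1 - s) * tau a b) * (1 - (1 - s) * t)
        = 1 - (1 - s) * (tau a b + t) + (1 - s)\<^sup>2 * (tau a b * t)"
      by (simp add: power2_eq_square algebra_simps)
    also have "\<dots> = 1 - (1 - s) * b * (1 + s * a)"
      unfolding t by (simp add: power2_eq_square algebra_simps)
    finally show ?thesis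
      using 2 by (simp add: R)
  next
    case 3
    then have "0 < a * b" by simp
    have "K2ad x y = 1 / (a * b)" using 3 by (simp add: K)
    moreover have "rejects s x y \<longleftrightarrow> 1 \<le> (1 - s\<^sup>2) * (a * b)"
      using 3 by (simp add: R mult_ac)
    ultimately show ?thesis using \<open>0 < a * b\<close> by (simp add: pos_divide_le_eq)
  qed
qed

lemma K2ad_in_unit_interval:
  assumes "0 \<le> x" "0 \<le> y"
  shows "K2ad x y \<in> {0..1}"
proof -
  define a b where "a = min x y" and "b = max x y"
  have ab: "0 \<le> a" "a \<le> b" using assms by (auto simp: a_def b_def)
  have K: "K2ad x y = (if b \<le> 1 then 1 else if a < 1 then 2 / tau a b - 1 / (tau a b)\<^sup>2 else 1 / (a * b))"
    by (simp add: K2ad_def a_def b_def Let_def)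
  consider "b \<le> 1" | "1 < b" "a < 1" | "1 < b" "1 \<le> a" by linarith
  then show ?thesis
  proof cases
    case 1
    then show ?thesis by (simp add: K)
  next
    case 2
    obtain t where "1 < tau a b" using tau_roots ab 2 by metis
    then have "0 \<le> 1 - 1 / tau a b" "1 - 1 / tau a b \<le> 1" by auto
    then have "(1 - 1 / tau a b)\<^sup>2 \<in> {0..1}" by (simp add: power_le_one)
    then show ?thesis
      using 2 one_minus_square_of_reciprocal[of "tau a b"]
      by (simp add: K)
  next
    case 3
    then have "1 \<le> a * b" using mult_mono[of 1 a 1 b] by simp
    then show ?thesis using 3 by (simp add: K)
  qed
qed

lemma measurable_K2ad [measurable (raw)]:
  assumes [measurable]: "f \<in> borel_measurable N" "g \<in> borel_measurable N"
  shows "(\<lambda>z. K2ad (f z) (g z)) \<in> borel_measurable N"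
  unfolding K2ad_def tau_def Let_def by measurable

section \<open>Validity of the merger\<close>

text \<open>Here \<open>\<psi>\<close> is the indicator of the rejection region, \<open>\<phi> x\<close> is the probability of rejecting when
  \<open>E1\<close> has the value \<open>x\<close>, and \<open>\<xi>\<close> is, up to the factor \<open>v - u\<close>, the probability of rejecting when \<open>E1\<close>
  has the two-point law on \<open>{u, v}\<close> and \<open>E2\<close> is given.\<close>

lemma prob_K2ad_le:
  fixes M :: "'a measure"
  assumes M: "prob_space M" and E: "e_variable M E1" "e_variable M E2"
    and ind: "prob_space.indep_var M borel E1 borel E2"
    and \<alpha>: "\<alpha> \<in> {0..1}"
  shows "measure M {\<omega> \<in> space M. K2ad (E1 \<omega>) (E2 \<omega>) \<le> \<alpha>} \<le> \<alpha>"
proof (cases "\<alpha> = 1")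
  case True
  then show ?thesis using prob_space.prob_le_1[OF M] by simp
next
  case False
  interpret prob_space M by fact
  define s where "s = sqrt (1 - \<alpha>)"
  have s: "0 < s" "s \<le> 1" and \<alpha>_eq: "\<alpha> = 1 - s\<^sup>2" using \<alpha> False by (auto simp: s_def)
  have [measurable]: "E1 \<in> borel_measurable M" "E2 \<in> borel_measurable M"
    and nonneg: "\<And>\<omega>. \<omega> \<in> space M \<Longrightarrow> 0 \<le> E1 \<omega>" "\<And>\<omega>. \<omega> \<in> space M \<Longrightarrow> 0 \<le> E2 \<omega>"
    and int2: "integrable M E2" and exp2: "expectation E2 \<le> 1"
    using E by (auto simp: e_variable_def)
  define A where "A = {z :: real \<times> real. K2ad (fst z) (snd z) \<le> \<alpha>}"
  have A: "A \<in> sets (borel \<Otimes>\<^sub>M borel)"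
  proof -
    have "{z \<in> space (borel \<Otimes>\<^sub>M borel). K2ad (fst z) (snd z) \<le> \<alpha>} \<in> sets (borel \<Otimes>\<^sub>M borel)"
      by measurable
    then show ?thesis by (simp add: A_def space_pair_measure)
  qed
  define \<phi> where "\<phi> x = measure M {\<omega> \<in> space M. (x, E2 \<omega>) \<in> A}" for x
  define \<psi> where "\<psi> x y = (of_bool (rejects s x y) :: real)" for x y
  have ev: "{\<omega> \<in> space M. (x, E2 \<omega>) \<in> A} \<in> events" for x
    unfolding A_def by simp
  have indic: "indicator {\<omega> \<in> space M. (x, E2 \<omega>) \<in> A} \<omega> = \<psi> x (E2 \<omega>)"
    if "0 \<le> x" "\<omega> \<in> space M" for x \<omega>
    using that nonneg K2ad_le_iff_rejects[OF s, of x "E2 \<omega>"]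
    by (auto simp: indicator_def A_def \<psi>_def \<alpha>_eq)
  have int\<psi>: "integrable M (\<lambda>\<omega>. \<psi> x (E2 \<omega>))" if "0 \<le> x" for x
  proof -
    have "integrable M (indicat_real {\<omega> \<in> space M. (x, E2 \<omega>) \<in> A})"
      using ev by (simp add: integrable_indicator_iff emeasure_eq_measure)
    then show ?thesis
      using indic[OF that] by (simp cong: Bochner_Integration.integrable_cong)
  qed
  have \<phi>: "\<phi> x = expectation (\<lambda>\<omega>. \<psi> x (E2 \<omega>))" if "0 \<le> x" for x
  proof -
    have "\<phi> x = expectation (indicator {\<omega> \<in> space M. (x, E2 \<omega>) \<in> A})"
      unfolding \<phi>_def using ev by simp
    also have "\<dots> = expectation (\<lambda>\<omega>. \<psi> x (E2 \<omega>))"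
      by (rule Bochner_Integration.integral_cong) (use indic[OF that] in auto)
    finally show ?thesis .
  qed
  have \<alpha>0: "0 \<le> \<alpha>" using \<alpha> by simp
  have \<psi>_below: "\<psi> x y \<le> \<alpha> * y" if "0 \<le> x" "x \<le> 1" "0 \<le> y" for x y
    using rejects_below_one_imp[OF s that] that \<alpha>0 by (auto simp: \<psi>_def \<alpha>_eq)
  have below: "\<phi> u \<le> \<alpha>" if u: "0 \<le> u" "u \<le> 1" for u
  proof -
    have "\<phi> u \<le> expectation (\<lambda>\<omega>. \<alpha> * E2 \<omega>)"
      unfolding \<phi>[OF u(1)]
      by (rule integral_mono) (use int\<psi> int2 u \<psi>_below nonneg in auto)
    also have "\<dots> \<le> \<alpha>" using exp2 \<alpha>0 by (simp add: mult_left_le)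
    finally show ?thesis .
  qed
  have chord: "(v - 1) * \<phi> u + (1 - u) * \<phi> v \<le> \<alpha> * (v - u)"
    if uv: "0 \<le> u" "u < 1" "1 < v" for u v
  proof -
    define \<xi> where "\<xi> y = (v - 1) * \<psi> u y + (1 - u) * \<psi> v y" for y
    have int\<xi>: "integrable M (\<lambda>\<omega>. \<xi> (E2 \<omega>))"
      unfolding \<xi>_def using int\<psi> uv by auto
    have "(v - 1) * \<phi> u + (1 - u) * \<phi> v = (\<integral>\<omega>. \<xi> (E2 \<omega>) \<partial>M)"
      using \<phi> int\<psi> uv by (simp add: \<xi>_def)
    also have "\<dots> \<le> \<alpha> * (v - u)"
    proof (rule expectation_le_of_two_point_laws[OF M E(2) int\<xi>])
      fix y :: real assume y: "0 \<le> y" "y \<le> 1"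
      have "\<psi> u y = 0"
        using not_rejects_unit_square[of s u y] s uv y by (simp add: \<psi>_def)
      moreover have "\<psi> v y \<le> \<alpha> * v"
        using \<psi>_below[of y v] uv y by (simp add: \<psi>_def rejects_commute)
      then have "(1 - u) * \<psi> v y \<le> (1 - u) * (\<alpha> * v)"
        using uv by (intro mult_left_mono) auto
      moreover have "(1 - u) * (\<alpha> * v) \<le> \<alpha> * (v - u)"
        using mult_left_mono[OF mult_diff_le[of u v] \<alpha>0] uv by (simp add: mult_ac)
      ultimately show "\<xi> y \<le> \<alpha> * (v - u)" by (simp add: \<xi>_def)
    next
      fix y z :: real assume yz: "0 \<le> y" "y < 1" "1 < z"
      show "(z - 1) * \<xi> y + (1 - y) * \<xi> z \<le> \<alpha> * (v - u) * (z - y)"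
        unfolding \<xi>_def \<psi>_def \<alpha>_eq by (rule four_point_inequality[OF s uv yz])
    qed
    finally show ?thesis .
  qed
  have "measure M {\<omega> \<in> space M. K2ad (E1 \<omega>) (E2 \<omega>) \<le> \<alpha>} = (\<integral>\<omega>. \<phi> (E1 \<omega>) \<partial>M)"
    using prob_indep_var_eq_integral_sections(1)[OF M ind A] by (simp add: A_def \<phi>_def)
  also have "\<dots> \<le> \<alpha>"
  proof (rule expectation_le_of_two_point_laws[OF M E(1) _ below chord])
    show "integrable M (\<lambda>\<omega>. \<phi> (E1 \<omega>))"
      unfolding \<phi>_def using prob_indep_var_eq_integral_sections(2)[OF M ind A]
      by (intro integrable_const_bound[where B = 1]) auto
  qed
  finally show ?thesis .
qed

theorem theorem3p6:
  shows "(\<forall>(M :: 'a measure) E1 E2.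
            prob_space M \<longrightarrow> e_variable M E1 \<longrightarrow> e_variable M E2 \<longrightarrow>
            prob_space.indep_var M borel E1 borel E2 \<longrightarrow>
            (\<forall>\<alpha>\<in>{0..1}. measure M {\<omega> \<in> space M. K2ad (E1 \<omega>) (E2 \<omega>) \<le> \<alpha>} \<le> \<alpha>)) \<and>
         e_to_p_merger TYPE('a) (\<lambda>x :: real ^ 2. K2ad (x $ 1) (x $ 2))"
proof (intro conjI)
  show "\<forall>(M :: 'a measure) E1 E2.
            prob_space M \<longrightarrow> e_variable M E1 \<longrightarrow> e_variable M E2 \<longrightarrow>
            prob_space.indep_var M borel E1 borel E2 \<longrightarrow>
            (\<forall>\<alpha>\<in>{0..1}. measure M {\<omega> \<in> space M. K2ad (E1 \<omega>) (E2 \<omega>) \<le> \<alpha>} \<le> \<alpha>)"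
    using prob_K2ad_le by blast
  show "e_to_p_merger TYPE('a) (\<lambda>x :: real ^ 2. K2ad (x $ 1) (x $ 2))"
    unfolding e_to_p_merger_def
  proof (intro conjI allI impI ballI)
    have "(\<lambda>x :: real ^ 2. x $ i) \<in> borel_measurable borel" for i
      by (intro borel_measurable_continuous_onI continuous_intros)
    then show "(\<lambda>x :: real ^ 2. K2ad (x $ 1) (x $ 2))
        \<in> borel_measurable (restrict_space borel {x. \<forall>i. 0 \<le> x $ i})"
      by (intro measurable_restrict_space1 measurable_K2ad)
  next
    fix x :: "real ^ 2" assume "\<forall>i. 0 \<le> x $ i"
    then show "K2ad (x $ 1) (x $ 2) \<in> {0..1}" by (intro K2ad_in_unit_interval) auto
  next
    fix M :: "'a measure" and E :: "2 \<Rightarrow> 'a \<Rightarrow> real" and \<alpha> :: real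
    assume M: "prob_space M" and E: "\<forall>i. e_variable M (E i)"
      and ind: "prob_space.indep_vars M (\<lambda>_. borel) E UNIV" and \<alpha>: "\<alpha> \<in> {0..1}"
    interpret prob_space M by fact
    have "indep_var borel (E 1) borel (E 2)"
      using indep_var_of_indep_vars[OF M ind, of 1 2] by simp
    then show "measure M {\<omega> \<in> space M.
        K2ad ((\<chi> i. E i \<omega>) $ 1) ((\<chi> i. E i \<omega>) $ 2) \<le> \<alpha>} \<le> \<alpha>"
      using prob_K2ad_le[OF M _ _ _ \<alpha>] E by simp
  qed
qed

end
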